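(* Let $(X,\mathcal{B})$ be a projective plane of order $q$, and let $G=(X,\mathcal{B})$ be the hypergraph whose vertices are the points of $X$ and whose edges are the lines in $\mathcal{B}$. If $q$ is odd, then $G$ is minimal non-odd-bipartite.
   Context: A projective plane of order $q$ consists of a set $X$ of $q^2+q+1$ points and a set $\mathcal{B}$ of $(q+1)$-subsets of $X$ (lines) such that any two points lie on a unique line. The hypergraph $G$ is then $(q+1)$-uniform. For $k$ even, a $k$-uniform hypergraph $G$ is odd-bipartite if there is a bipartition $\{U,U^c\}$ of $V(G)$ such that every edge meets $U$ (and hence $U^c$) in an odd number of vertices. It is minimal non-odd-bipartite if it is not odd-bipartite but $G-e$ (delete the edge $e$ from the edge set) is odd-bipartite for every edge $e$. *)

theory Defs
  imports Main
begin

definition projective_plane :: "nat \<Rightarrow> 'a set \<Rightarrow> 'a set set \<Rightarrow> bool" where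
  "projective_plane q X B \<longleftrightarrow>
     finite X \<and> card X = q\<^sup>2 + q + 1 \<and>
     (\<forall>L\<in>B. L \<subseteq> X \<and> card L = q + 1) \<and>
     (\<forall>x\<in>X. \<forall>y\<in>X. x \<noteq> y \<longrightarrow> (\<exists>!L. L \<in> B \<and> x \<in> L \<and> y \<in> L))"

definition uniform_hypergraph :: "nat \<Rightarrow> 'a set \<Rightarrow> 'a set set \<Rightarrow> bool" where
  "uniform_hypergraph k V E \<longleftrightarrow> finite V \<and> (\<forall>e\<in>E. e \<subseteq> V \<and> card e = k)"

text \<open>
  Only meaningful for \<open>k\<close>-uniform hypergraphs with \<open>k\<close> even; then every edge also meets
  \<open>V - U\<close> in an odd number of vertices. The parts \<open>U\<close> and \<open>V - U\<close> are automatically nonempty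
  as soon as there is an edge.
\<close>
definition odd_bipartite :: "'a set \<Rightarrow> 'a set set \<Rightarrow> bool" where
  "odd_bipartite V E \<longleftrightarrow> (\<exists>U\<subseteq>V. \<forall>e\<in>E. odd (card (e \<inter> U)))"

text \<open>
  Even uniformity is the domain of the notion, so it stands outside the negation instead of
  being a part of \<^const>\<open>odd_bipartite\<close>.
\<close>
definition minimal_non_odd_bipartite :: "nat \<Rightarrow> 'a set \<Rightarrow> 'a set set \<Rightarrow> bool" where
  "minimal_non_odd_bipartite k V E \<longleftrightarrow>
     even k \<and> uniform_hypergraph k V E \<and>
     \<not> odd_bipartite V E \<and> (\<forall>e\<in>E. odd_bipartite V (E - {e}))"

end

theory Submission
  imports Defs
begin

text \<open>
  Every point lies on \<open>q + 1\<close> lines, an even number, whereas the number \<open>q\<^sup>2 + q + 1\<close> of lines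
  is odd. If every line met \<open>U\<close> in an odd number of points, the number of incidences between
  \<open>U\<close> and the lines would thus be both even and odd. After the deletion of a line \<open>e\<close>, the set
  \<open>U = e\<close> itself is a witness, as two distinct lines meet in exactly one point.
\<close>

lemma projective_plane_finite_lines:
  assumes "projective_plane q X B"
  shows "finite B"
proof (rule finite_subset)
  show "B \<subseteq> Pow X" "finite (Pow X)"
    using assms by (auto simp: projective_plane_def)
qed

lemma projective_plane_join:
  assumes "projective_plane q X B" "x \<in> X" "y \<in> X" "x \<noteq> y"
  shows "\<exists>L. L \<in> B \<and> x \<in> L \<and> y \<in> L"
proof -
  have "\<exists>!L. L \<in> B \<and> x \<in> L \<and> y \<in> L"
    using assms by (simp add: projective_plane_def)
  then show ?thesis
    by (rule ex1_implies_ex)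
qed

lemma projective_plane_line_unique:
  assumes "projective_plane q X B" "L \<in> B" "M \<in> B"
    and "x \<in> L" "x \<in> M" "y \<in> L" "y \<in> M" "x \<noteq> y"
  shows "L = M"
proof -
  have "x \<in> X" "y \<in> X"
    using assms by (auto simp: projective_plane_def)
  then have "\<exists>!L. L \<in> B \<and> x \<in> L \<and> y \<in> L"
    using assms by (simp add: projective_plane_def)
  then show ?thesis
    using assms by blast
qed

text \<open>Removing \<open>x\<close> from each line through it leaves sets of size \<open>q\<close>
  that partition the other \<open>q * (q + 1)\<close> points. Cancelling \<open>q\<close> needs
  \<open>q > 0\<close>: for \<open>q = 0\<close> the plane is a single point and \<open>B\<close>
  may be empty.\<close>

lemma projective_plane_card_lines_through:
  assumes P: "projective_plane q X B" and "q > 0" and x: "x \<in> X"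
  shows "card {L \<in> B. x \<in> L} = q + 1"
proof -
  let ?R = "{L \<in> B. x \<in> L}"
  have fin: "finite X" and line: "\<And>L. L \<in> B \<Longrightarrow> L \<subseteq> X \<and> card L = q + 1"
    using P by (auto simp: projective_plane_def)
  have "\<exists>L\<in>?R. y \<in> L" if "y \<in> X - {x}" for y
    using projective_plane_join[OF P x, of y] that by blast
  then have cover: "X - {x} = (\<Union>L\<in>?R. L - {x})"
    using line by blast
  have "card (X - {x}) = (\<Sum>L\<in>?R. card (L - {x}))"
    unfolding cover
  proof (rule card_UN_disjoint)
    show "finite ?R"
      using projective_plane_finite_lines[OF P] by simp
    show "\<forall>L\<in>?R. finite (L - {x})"
      using line fin by (blast intro: finite_subset)
    show "\<forall>L\<in>?R. \<forall>M\<in>?R. L \<noteq> M \<longrightarrow> (L - {x}) \<inter> (M - {x}) = {}"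
      using projective_plane_line_unique[OF P] by blast
  qed
  also have "\<dots> = (\<Sum>L\<in>?R. q)"
    using line by (intro sum.cong) auto
  also have "\<dots> = q * card ?R"
    by simp
  finally have "q * card ?R = q * (q + 1)"
    using P x by (simp add: projective_plane_def power2_eq_square)
  with \<open>q > 0\<close> show ?thesis
    by (simp only: mult_cancel1) auto
qed

text \<open>Double counting of the pairs of a point of \<open>U\<close> and a line through
  it.\<close>

lemma projective_plane_incidences:
  assumes P: "projective_plane q X B" and "q > 0" and "U \<subseteq> X"
  shows "(\<Sum>L\<in>B. card (L \<inter> U)) = (q + 1) * card U"
proof -
  have "finite U"
    using assms by (auto simp: projective_plane_def intro: finite_subset)
  moreover have "\<forall>x\<in>U. card {L \<in> B. x \<in> L} = q + 1"
    using projective_plane_card_lines_through[OF P \<open>q > 0\<close>] \<open>U \<subseteq> X\<close> by blast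
  ultimately have "(\<Sum>L\<in>B. card {x \<in> U. x \<in> L}) = (q + 1) * card U"
    by (intro sum_multicount projective_plane_finite_lines[OF P])
  moreover have "{x \<in> U. x \<in> L} = L \<inter> U" for L
    by blast
  ultimately show ?thesis
    by simp
qed

text \<open>The incidence count for \<open>U = X\<close>, where each line contributes all of its
  \<open>q + 1\<close> points.\<close>

lemma projective_plane_card_lines:
  assumes P: "projective_plane q X B" and "q > 0"
  shows "card B = q\<^sup>2 + q + 1"
proof -
  have "(\<Sum>L\<in>B. card (L \<inter> X)) = (\<Sum>L\<in>B. q + 1)"
    using P by (intro sum.cong) (auto simp: projective_plane_def Int_absorb2)
  then have "(q + 1) * card B = (q + 1) * card X"
    using projective_plane_incidences[OF assms subset_refl] by (simp add: mult.commute)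
  then have "card B = card X"
    by (simp only: mult_cancel1) auto
  then show ?thesis
    using P by (simp add: projective_plane_def)
qed

text \<open>Uniqueness of joining lines allows at most one common point. That there is one is not an
  axiom here; it follows by counting the lines through a point of \<open>L\<close> outside
  \<open>M\<close>.\<close>

lemma projective_plane_card_lines_Int:
  assumes P: "projective_plane q X B" and "q > 0"
    and L: "L \<in> B" and M: "M \<in> B" and "L \<noteq> M"
  shows "card (L \<inter> M) = 1"
proof -
  have fin: "finite X" and line: "\<And>L. L \<in> B \<Longrightarrow> L \<subseteq> X \<and> card L = q + 1"
    using P by (auto simp: projective_plane_def)
  have "finite M"
    using line M fin by (blast intro: finite_subset)
  then have "\<not> L \<subseteq> M"
    using card_subset_eq[of M L] line L M \<open>L \<noteq> M\<close> by auto
  then obtain x where x: "x \<in> L" "x \<notin> M"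
    by blast
  let ?R = "{K \<in> B. x \<in> K}"
  have "\<forall>y\<in>M. \<exists>K. K \<in> B \<and> x \<in> K \<and> y \<in> K"
  proof
    fix y
    assume "y \<in> M"
    then have "x \<in> X" "y \<in> X" "x \<noteq> y"
      using x line L M by auto
    then show "\<exists>K. K \<in> B \<and> x \<in> K \<and> y \<in> K"
      using projective_plane_join[OF P] by blast
  qed
  then obtain f where f: "\<And>y. y \<in> M \<Longrightarrow> f y \<in> B \<and> x \<in> f y \<and> y \<in> f y"
    by metis
  \<comment> \<open>Joining \<open>x\<close> to the points of \<open>M\<close> already yields \<open>q + 1\<close> lines, hence all lines through \<open>x\<close>.\<close>
  have "inj_on f M"
  proof (rule inj_onI, rule ccontr)
    fix y z
    assume yz: "y \<in> M" "z \<in> M" "f y = f z" "y \<noteq> z"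
    \<comment> \<open>A line joining \<open>x\<close> to two points of \<open>M\<close> would be
      \<open>M\<close> itself, which misses \<open>x\<close>.\<close>
    then have "f y = M"
      using f[of y] f[of z] M by (intro projective_plane_line_unique[OF P, of _ _ y z]) auto
    then show False
      using f[of y] yz x by simp
  qed
  then have "card (f ` M) = q + 1"
    using line M by (simp add: card_image)
  moreover have "x \<in> X"
    using line L x by blast
  ultimately have "card (f ` M) = card ?R"
    using projective_plane_card_lines_through[OF P \<open>q > 0\<close>] by simp
  then have "f ` M = ?R"
    using f projective_plane_finite_lines[OF P] by (intro card_subset_eq) auto
  \<comment> \<open>\<open>L\<close> passes through \<open>x\<close>, so it is one of the joins and
    contains a point of \<open>M\<close>.\<close>
  then obtain y where y: "y \<in> M" "L = f y"
    using L x by blast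
  then have "y \<in> L"
    using f by blast
  then have "L \<inter> M = {y}"
    using y(1) projective_plane_line_unique[OF P L M] \<open>L \<noteq> M\<close> by blast
  then show ?thesis
    by simp
qed

theorem theorem4p11:
  fixes q :: nat and X :: "'a set" and B :: "'a set set"
  assumes "projective_plane q X B" and "odd q"
  shows "minimal_non_odd_bipartite (q + 1) X B"
proof -
  note P = \<open>projective_plane q X B\<close>
  have "q > 0"
    using \<open>odd q\<close> by (rule odd_pos)
  have "\<not> odd_bipartite X B"
  proof
    assume "odd_bipartite X B"
    then obtain U where U: "U \<subseteq> X" "\<forall>L\<in>B. odd (card (L \<inter> U))"
      unfolding odd_bipartite_def by blast
    \<comment> \<open>A sum has the parity of its number of odd summands, which is
      \<open>card B\<close> here.\<close>
    have "{L \<in> B. odd (card (L \<inter> U))} = B"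
      using U by blast
    then have "odd (\<Sum>L\<in>B. card (L \<inter> U))"
      using even_sum_iff[OF projective_plane_finite_lines[OF P], of "\<lambda>L. card (L \<inter> U)"]
        projective_plane_card_lines[OF P \<open>q > 0\<close>] \<open>odd q\<close> by simp
    then show False
      using projective_plane_incidences[OF P \<open>q > 0\<close> U(1)] \<open>odd q\<close> by simp
  qed
  moreover have "odd_bipartite X (B - {e})" if "e \<in> B" for e
    unfolding odd_bipartite_def
  proof (intro exI[of _ e] conjI ballI)
    show "e \<subseteq> X"
      using P that by (simp add: projective_plane_def)
    show "odd (card (L \<inter> e))" if "L \<in> B - {e}" for L
      using projective_plane_card_lines_Int[OF P \<open>q > 0\<close>, of L e] that \<open>e \<in> B\<close> by simp
  qed
  moreover have "uniform_hypergraph (q + 1) X B"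
    using P by (simp add: projective_plane_def uniform_hypergraph_def)
  ultimately show ?thesis
    using \<open>odd q\<close> by (simp add: minimal_non_odd_bipartite_def)
qed

end
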